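(* Let $q\ge1$ and let $A=(a_1,\ldots,a_q)$, $B=(b_1,\ldots,b_q)$ be real vectors with $B\prec^W A$ and $a_1,b_1>1$. Then for $x>0$ and $0<\sigma\le1$ the inequality $$ {}_{q+1}F_q(\sigma,A;B;-x)<\frac{1}{\left(1+x\prod_{i=1}^{q}\frac{a_i-1}{b_i-1}\right)^{\sigma}} $$ holds.
   Context: $B\prec^W A$ means: $0<a_1\le\cdots\le a_q$, $0<b_1\le\cdots\le b_q$, and $\sum_{i=1}^{k}a_i\le\sum_{i=1}^{k}b_i$ for $k=1,\ldots,q$. The generalized hypergeometric function is ${}_{q+1}F_q(\sigma,A;B;z)=\sum_{n=0}^{\infty}\frac{(\sigma)_n(a_1)_n\cdots(a_q)_n}{(b_1)_n\cdots(b_q)_n\,n!}z^n$ for $|z|<1$, extended by analytic continuation to $\mathbb{C}\setminus[1,\infty)$; $(a)_0=1$, $(a)_n=a(a+1)\cdots(a+n-1)$.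
   Formalization: The formal theorem additionally assumes A ≠ B; for A = B both sides equal (1+x)^(−σ), so the strict inequality as printed fails exactly in that case. *)

theory Defs
  imports "HOL-Complex_Analysis.Complex_Analysis"
begin

text \<open>Vectors of length \<open>q\<close> are functions on \<open>nat\<close>, of which only the entries with index in
  \<open>{1..q}\<close> are used. The first vector argument is the smaller one: \<open>B \<prec>\<^sup>W A\<close> is
  \<open>weak_supermajorized q b a\<close>.\<close>

definition weak_supermajorized :: "nat \<Rightarrow> (nat \<Rightarrow> real) \<Rightarrow> (nat \<Rightarrow> real) \<Rightarrow> bool" where
  "weak_supermajorized q b a \<longleftrightarrow>
     0 < a 1 \<and> mono_on {1..q} a \<and> 0 < b 1 \<and> mono_on {1..q} b \<and>
     (\<forall>k\<in>{1..q}. (\<Sum>i=1..k. a i) \<le> (\<Sum>i=1..k. b i))"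

definition hypergeometric_coeff ::
  "nat \<Rightarrow> complex \<Rightarrow> (nat \<Rightarrow> complex) \<Rightarrow> (nat \<Rightarrow> complex) \<Rightarrow> nat \<Rightarrow> complex" where
  "hypergeometric_coeff q s a b n =
     (pochhammer s n * (\<Prod>i=1..q. pochhammer (a i) n)) /
     ((\<Prod>i=1..q. pochhammer (b i) n) * fact n)"

definition cut_plane :: "complex set" where
  "cut_plane = - (complex_of_real ` {1..})"

definition hypergeometric_continuation ::
  "nat \<Rightarrow> complex \<Rightarrow> (nat \<Rightarrow> complex) \<Rightarrow> (nat \<Rightarrow> complex) \<Rightarrow> (complex \<Rightarrow> complex) \<Rightarrow> bool" where
  "hypergeometric_continuation q s a b F \<longleftrightarrow>
     F holomorphic_on cut_plane \<and>
     (\<forall>w\<in>ball 0 1. (\<lambda>n. hypergeometric_coeff q s a b n * w ^ n) sums F w)"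

text \<open>The value at \<open>z\<close> of the function with \<open>q + 1\<close> upper and \<open>q\<close> lower parameters. It is
  meaningful for \<open>z\<close> in the cut plane when the continuation exists, and unspecified otherwise.
  The description is of the value and not of the function, since a continuation is only
  unique on the cut plane.\<close>

definition hypergeometric ::
  "nat \<Rightarrow> complex \<Rightarrow> (nat \<Rightarrow> complex) \<Rightarrow> (nat \<Rightarrow> complex) \<Rightarrow> complex \<Rightarrow> complex" where
  "hypergeometric q s a b z =
     (THE w. \<exists>F. hypergeometric_continuation q s a b F \<and> w = F z)"

lemma open_cut_plane: "open cut_plane"
proof -
  have "closed (complex_of_real ` {1..})"
    by (rule closed_injective_linear_image) (auto intro: linear_of_real inj_of_real)
  then show ?thesis
    by (simp add: cut_plane_def open_Compl)
qed

lemma ball_subset_cut_plane: "ball 0 1 \<subseteq> cut_plane"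
  by (auto simp: cut_plane_def)

lemma connected_cut_plane: "connected cut_plane"
proof (rule starlike_imp_connected)
  have "closed_segment 0 z \<subseteq> cut_plane" if z: "z \<in> cut_plane" for z :: complex
  proof
    fix w assume "w \<in> closed_segment 0 z"
    then obtain u where u: "0 \<le> u" "u \<le> 1" "w = of_real u * z"
      by (auto simp: in_segment scaleR_conv_of_real)
    show "w \<in> cut_plane"
    proof (rule ccontr)
      assume "w \<notin> cut_plane"
      then obtain t :: real where t: "1 \<le> t" "w = of_real t"
        by (auto simp: cut_plane_def)
      with u have "u \<noteq> 0" by auto
      then have "z = of_real (t / u)"
        using u t by (simp add: field_simps)
      moreover have "1 \<le> t / u"
        using u t \<open>u \<noteq> 0\<close> by (simp add: field_simps)
      ultimately show False
        using z unfolding cut_plane_def by blast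
    qed
  qed
  moreover have "0 \<in> cut_plane"
    using ball_subset_cut_plane by auto
  ultimately show "starlike cut_plane"
    unfolding starlike_def by blast
qed

lemma hypergeometric_eqI:
  assumes F: "hypergeometric_continuation q s a b F" and z: "z \<in> cut_plane"
  shows "hypergeometric q s a b z = F z"
proof -
  have "G z = F z" if G: "hypergeometric_continuation q s a b G" for G
  proof -
    have hol: "F holomorphic_on cut_plane" "G holomorphic_on cut_plane"
      using F G by (simp_all add: hypergeometric_continuation_def)
    have eq: "G w = F w" if "w \<in> ball 0 1" for w
      using F G that unfolding hypergeometric_continuation_def by (meson sums_unique2)
    have "ball (0 :: complex) 1 \<noteq> {}"
      by simp
    from analytic_continuation_open[OF open_ball open_cut_plane this connected_cut_plane
        ball_subset_cut_plane hol(2) hol(1) eq z]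
    show ?thesis .
  qed
  then show ?thesis
    unfolding hypergeometric_def using F by (blast intro: the_equality)
qed

end

theory Submission
  imports Defs
begin

text \<open>
  Put \<open>\<alpha> = a - 1\<close>, \<open>\<beta> = b - 1\<close> and \<open>c n = (\<Prod>i. (\<alpha>\<^sub>i)\<^sub>n / (\<beta>\<^sub>i)\<^sub>n)\<close>. The function
  \<open>f s = (\<Prod>i. \<Gamma>(\<alpha>\<^sub>i + s) / \<Gamma>(\<beta>\<^sub>i + s))\<close> satisfies \<open>f' = f \<cdot> (\<Sum>i. \<psi>(\<alpha>\<^sub>i + s) - \<psi>(\<beta>\<^sub>i + s))\<close>, and
  weak supermajorization gives the derivatives of the second factor alternating signs. Hence \<open>f\<close>
  is completely monotone, and \<open>c\<close> is the moment sequence of a probability measure on \<open>[0, 1]\<close>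
  with mean \<open>c 1 = (\<Prod>i. (a\<^sub>i - 1) / (b\<^sub>i - 1))\<close>. Since \<open>c (n + 1) / c 1\<close> is the quotient of Pochhammer
  symbols for \<open>a\<close> and \<open>b\<close>, the hypergeometric function is the mean of \<open>t (1 - z t) powr (-\<sigma>)\<close>
  divided by \<open>c 1\<close>. For \<open>z = -x\<close> this kernel is strictly concave in \<open>t\<close>, and Jensen's
  inequality gives the bound; it is strict because the variance \<open>c 2 - (c 1)\<^sup>2\<close> is positive.

  Instead of the measure itself, its discrete Bernstein approximations on \<open>{k / N | k \<le> N}\<close> are
  used: by Montel's theorem a subsequence of the corresponding means converges to the
  analytic continuation on the whole cut plane.
\<close>

subsection \<open>Weak supermajorization\<close>

text \<open>Summation by parts. The value \<open>w (Suc n)\<close> cancels on the right, so it may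
  be chosen freely.\<close>

lemma abel_sum:
  fixes w d :: "nat \<Rightarrow> real"
  shows "(\<Sum>i=1..n. w i * d i) =
    w (Suc n) * (\<Sum>i=1..n. d i) + (\<Sum>k=1..n. (w k - w (Suc k)) * (\<Sum>i=1..k. d i))"
  by (induction n) (simp_all add: algebra_simps)

lemma abel_sum_nonneg:
  fixes w d :: "nat \<Rightarrow> real"
  assumes "mono_on {1..n} w" and "\<And>i. i \<in> {1..n} \<Longrightarrow> w i \<le> 0"
    and d: "\<And>k. k \<in> {1..n} \<Longrightarrow> (\<Sum>i=1..k. d i) \<le> 0"
  shows "0 \<le> (\<Sum>i=1..n. w i * d i)"
proof -
  \<comment> \<open>Cutting \<open>w\<close> off to zero beyond \<open>n\<close> removes the
    boundary term; the last difference becomes \<open>w n\<close>, which is nonpositive like the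
    others.\<close>
  define v where "v i = (if i \<le> n then w i else 0)" for i
  have "0 \<le> (\<Sum>k=1..n. (v k - v (Suc k)) * (\<Sum>i=1..k. d i))"
    using assms by (intro sum_nonneg mult_nonpos_nonpos) (auto simp: v_def mono_on_def)
  moreover have "(\<Sum>i=1..n. w i * d i) = (\<Sum>i=1..n. v i * d i)"
    by (intro sum.cong) (auto simp: v_def)
  ultimately show ?thesis
    using abel_sum[of v d n] by (simp add: v_def)
qed

lemma weak_supermajorized_pos:
  assumes "weak_supermajorized q b a" and "i \<in> {1..q}"
  shows "a i > 0" and "b i > 0"
proof -
  have "a 1 \<le> a i" "b 1 \<le> b i"
    using assms by (auto simp: weak_supermajorized_def mono_on_def)
  with assms show "a i > 0" "b i > 0"
    by (auto simp: weak_supermajorized_def)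
qed

lemma weak_supermajorized_shift:
  assumes "weak_supermajorized q b a" and "a 1 + s > 0" and "b 1 + s > 0"
  shows "weak_supermajorized q (\<lambda>i. b i + s) (\<lambda>i. a i + s)"
  using assms by (auto simp: weak_supermajorized_def mono_on_def sum.distrib)

lemma weak_supermajorized_slope_sum:
  assumes ab: "weak_supermajorized q b a"
    and mono: "mono_on {0<..} w" and neg: "\<And>x. x > 0 \<Longrightarrow> w x \<le> (0::real)"
  shows "0 \<le> (\<Sum>i=1..q. w (b i) * (a i - b i))"
proof (rule abel_sum_nonneg)
  show "mono_on {1..q} (\<lambda>i. w (b i))"
    using ab weak_supermajorized_pos[OF ab] mono
    by (auto simp: weak_supermajorized_def mono_on_def)
qed (use ab weak_supermajorized_pos[OF ab] neg in
      \<open>auto simp: weak_supermajorized_def sum_subtractf\<close>)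

text \<open>Summing the tangent inequalities of the convex \<open>h\<close> at the points
  \<open>b i\<close> reduces the claim to slopes times \<open>a i - b i\<close>; the slopes
  \<open>h' (b i)\<close> are nonpositive and increase with \<open>i\<close>.\<close>

lemma weak_supermajorized_sum_le:
  assumes ab: "weak_supermajorized q b a"
    and h: "\<And>x. x > 0 \<Longrightarrow> (h has_real_derivative h' x) (at x)"
    and h': "\<And>x. x > 0 \<Longrightarrow> (h' has_real_derivative h'' x) (at x)"
    and neg: "\<And>x. x > 0 \<Longrightarrow> h' x \<le> 0" and pos: "\<And>x. x > 0 \<Longrightarrow> h'' x \<ge> 0"
  shows "(\<Sum>i=1..q. h (b i)) \<le> (\<Sum>i=1..q. h (a i))"
proof -
  have convex: "convex_on {0<..} h"
    using h h' pos by (intro f''_ge0_imp_convex[of _ h h' h'']) auto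
  have tangent: "h' (b i) * (a i - b i) \<le> h (a i) - h (b i)" if "i \<in> {1..q}" for i
    using weak_supermajorized_pos[OF ab that] h
    by (intro convex_on_imp_above_tangent[OF convex])
       (auto simp: interior_open intro: has_field_derivative_at_within)
  have "mono_on {0<..} h'"
  proof (rule mono_onI)
    fix x y :: real assume "x \<in> {0<..}" "x \<le> y"
    then show "h' x \<le> h' y"
      by (metis DERIV_nonneg_imp_nondecreasing greaterThan_iff h' order_less_le_trans pos)
  qed
  then have "0 \<le> (\<Sum>i=1..q. h' (b i) * (a i - b i))"
    by (intro weak_supermajorized_slope_sum[OF ab]) (auto simp: neg)
  also have "\<dots> \<le> (\<Sum>i=1..q. h (a i) - h (b i))"
    by (intro sum_mono tangent)
  finally show ?thesis
    by (simp add: sum_subtractf)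
qed

text \<open>Strict tangent inequality at \<open>y\<close> for the convex function
  \<open>ln ((x + 1) / x)\<close>. It comes from \<open>ln u < u - 1\<close>, where
  \<open>- ln u\<close> is the difference of the two logarithms.\<close>

lemma ln_ratio_tangent_less:
  fixes x y :: real
  assumes "x > 0" "y > 0" "x \<noteq> y"
  shows "- (1 / (y * (y + 1))) * (x - y) < ln ((x + 1) / x) - ln ((y + 1) / y)"
proof -
  define u where "u = x * (y + 1) / (y * (x + 1))"
  have u: "u > 0" "u \<noteq> 1"
    using assms by (simp_all add: u_def) (simp add: field_simps)
  have "u - 1 = (x - y) / (y * (x + 1))"
    using assms by (simp add: u_def diff_divide_eq_iff divide_simps) (simp add: algebra_simps)
  \<comment> \<open>Replacing \<open>x + 1\<close> by \<open>y + 1\<close> enlarges the quotient in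
    both cases, since its numerator changes sign together with the comparison of
    denominators.\<close>
  also have "\<dots> \<le> (x - y) / (y * (y + 1))"
  proof (cases "x \<ge> y")
    case True
    then show ?thesis
      using assms by (intro divide_left_mono mult_left_mono) auto
  next
    case False
    then show ?thesis
      using assms by (intro divide_left_mono_neg mult_left_mono) auto
  qed
  finally have "u - 1 \<le> (x - y) / (y * (y + 1))" .
  moreover have "ln u < u - 1"
    using ln_le_minus_one[of u] ln_eq_minus_one[of u] u by fastforce
  moreover have "ln ((x + 1) / x) - ln ((y + 1) / y) = - ln u"
    using assms by (simp add: u_def ln_div ln_mult)
  ultimately show ?thesis
    by simp
qed

text \<open>Taking logarithms gives sums of a strictly convex decreasing function, and one index
  with a strict tangent inequality suffices. For \<alpha> and \<beta> this yields the positive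
  variance.\<close>

lemma weak_supermajorized_prod_less:
  assumes ab: "weak_supermajorized q b a" and ne: "\<exists>i\<in>{1..q}. a i \<noteq> b i"
  shows "(\<Prod>i=1..q. (b i + 1) / b i) < (\<Prod>i=1..q. (a i + 1) / a i)"
proof -
  note pos = weak_supermajorized_pos[OF ab]
  define w :: "real \<Rightarrow> real" where "w y = - (1 / (y * (y + 1)))" for y
  have "mono_on {0<..} w"
    by (rule mono_onI) (auto simp: w_def intro!: divide_left_mono mult_mono)
  then have "0 \<le> (\<Sum>i=1..q. w (b i) * (a i - b i))"
    by (rule weak_supermajorized_slope_sum[OF ab]) (simp add: w_def)
  also have "\<dots> < (\<Sum>i=1..q. ln ((a i + 1) / a i) - ln ((b i + 1) / b i))"
  proof (rule sum_strict_mono_ex1)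
    show "\<forall>i\<in>{1..q}. w (b i) * (a i - b i) \<le> ln ((a i + 1) / a i) - ln ((b i + 1) / b i)"
    proof
      fix i assume "i \<in> {1..q}"
      then show "w (b i) * (a i - b i) \<le> ln ((a i + 1) / a i) - ln ((b i + 1) / b i)"
        using ln_ratio_tangent_less[of "a i" "b i"] pos[of i]
        by (cases "a i = b i") (auto simp: w_def)
    qed
    from ne obtain i where "i \<in> {1..q}" "a i \<noteq> b i"
      by blast
    then show "\<exists>i\<in>{1..q}. w (b i) * (a i - b i) < ln ((a i + 1) / a i) - ln ((b i + 1) / b i)"
      using ln_ratio_tangent_less[of "a i" "b i"] pos[of i] by (intro bexI[of _ i]) (auto simp: w_def)
  qed simp
  finally have less: "(\<Sum>i=1..q. ln ((b i + 1) / b i)) < (\<Sum>i=1..q. ln ((a i + 1) / a i))"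
    by (simp add: sum_subtractf)
  have ratio_pos: "0 < (a i + 1) / a i" "0 < (b i + 1) / b i" if "i \<in> {1..q}" for i
    using pos[OF that] by (simp_all add: add_pos_pos)
  have "ln (\<Prod>i=1..q. (b i + 1) / b i) = (\<Sum>i=1..q. ln ((b i + 1) / b i))"
    by (rule ln_prod) (use ratio_pos(2) in \<open>fastforce+\<close>)
  moreover have "ln (\<Prod>i=1..q. (a i + 1) / a i) = (\<Sum>i=1..q. ln ((a i + 1) / a i))"
    by (rule ln_prod) (use ratio_pos(1) in \<open>fastforce+\<close>)
  moreover have "0 < (\<Prod>i=1..q. (b i + 1) / b i)" "0 < (\<Prod>i=1..q. (a i + 1) / a i)"
    using ratio_pos by (intro prod_pos; blast)+
  ultimately show ?thesis
    using less by (metis ln_less_cancel_iff)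
qed

subsection \<open>Complete monotonicity of Gamma quotients\<close>

text \<open>\<open>monotone_order m f\<close> says that \<open>f, -f', f'', \<dots>\<close> are nonnegative on \<open>[0, \<infinity>)\<close> up to order \<open>m\<close>,
  so that \<open>f\<close> is completely monotone when this holds for all \<open>m\<close>. The recursion avoids the
  Leibniz formula for higher derivatives of products.\<close>

primrec monotone_order :: "nat \<Rightarrow> (real \<Rightarrow> real) \<Rightarrow> bool" where
  "monotone_order 0 f \<longleftrightarrow> (\<forall>s\<ge>0. 0 \<le> f s)"
| "monotone_order (Suc m) f \<longleftrightarrow> (\<forall>s\<ge>0. 0 \<le> f s) \<and>
     (\<exists>g. (\<forall>s\<ge>0. (f has_real_derivative - g s) (at s)) \<and> monotone_order m g)"

lemma monotone_order_nonneg: "monotone_order m f \<Longrightarrow> s \<ge> 0 \<Longrightarrow> 0 \<le> f s"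
  by (cases m) auto

lemma monotone_order_SucI:
  assumes "\<And>s. s \<ge> 0 \<Longrightarrow> 0 \<le> f s"
    and "\<And>s. s \<ge> 0 \<Longrightarrow> (f has_real_derivative - g s) (at s)" and "monotone_order m g"
  shows "monotone_order (Suc m) f"
  using assms by auto

lemma monotone_order_SucD: "monotone_order (Suc m) f \<Longrightarrow> monotone_order m f"
proof (induction m arbitrary: f)
  case (Suc m)
  then obtain g where "\<forall>s\<ge>0. 0 \<le> f s" "\<forall>s\<ge>0. (f has_real_derivative - g s) (at s)"
      and "monotone_order (Suc m) g"
    by auto
  with Suc.IH[of g] show ?case
    by auto
qed auto

lemma monotone_order_add:
  "monotone_order m f \<Longrightarrow> monotone_order m g \<Longrightarrow> monotone_order m (\<lambda>s. f s + g s)"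
proof (induction m arbitrary: f g)
  case (Suc m)
  then obtain f' g' where
      f': "\<forall>s\<ge>0. (f has_real_derivative - f' s) (at s)" "monotone_order m f'" and
      g': "\<forall>s\<ge>0. (g has_real_derivative - g' s) (at s)" "monotone_order m g'"
    by auto
  have "((\<lambda>s. f s + g s) has_real_derivative - (f' s + g' s)) (at s)" if "s \<ge> 0" for s
    using f' g' that by (auto intro!: derivative_eq_intros)
  then show ?case
    by (intro monotone_order_SucI[OF _ _ Suc.IH[OF f'(2) g'(2)]]) (use Suc.prems in auto)
qed auto

text \<open>The product rule leaves the undifferentiated factors at order \<open>Suc m\<close>; they
  are lowered to \<open>m\<close> before the induction hypothesis is applied.\<close>

lemma monotone_order_mult:
  "monotone_order m f \<Longrightarrow> monotone_order m g \<Longrightarrow> monotone_order m (\<lambda>s. f s * g s)"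
proof (induction m arbitrary: f g)
  case (Suc m)
  then obtain f' g' where
      f': "\<forall>s\<ge>0. (f has_real_derivative - f' s) (at s)" "monotone_order m f'" and
      g': "\<forall>s\<ge>0. (g has_real_derivative - g' s) (at s)" "monotone_order m g'"
    by auto
  have deriv: "((\<lambda>s. f s * g s) has_real_derivative - (f' s * g s + f s * g' s)) (at s)" if "s \<ge> 0" for s
    using f' g' that by (auto intro!: derivative_eq_intros)
  have "monotone_order m (\<lambda>s. f' s * g s + f s * g' s)"
    using f' g' Suc.prems[THEN monotone_order_SucD] by (intro monotone_order_add Suc.IH)
  from monotone_order_SucI[OF _ deriv this] Suc.prems show ?case
    by auto
qed auto

lemma monotone_order_antimono:
  assumes "monotone_order (Suc m) f" and "0 \<le> s" and "s \<le> t"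
  shows "f t \<le> f s"
proof -
  from assms obtain g where g: "\<forall>s\<ge>0. (f has_real_derivative - g s) (at s)" "monotone_order m g"
    by auto
  show ?thesis
  proof (rule DERIV_nonpos_imp_nonincreasing[OF \<open>s \<le> t\<close>])
    fix x assume "s \<le> x"
    with \<open>0 \<le> s\<close> have "0 \<le> x"
      by simp
    then show "\<exists>y. (f has_real_derivative y) (at x) \<and> y \<le> 0"
      using g monotone_order_nonneg[OF g(2)] by (intro exI[of _ "- g x"]) simp
  qed
qed

text \<open>One order is lost because the nonnegativity of the difference already rests on the first
  derivative. Minus its derivative is the same difference formed from \<open>g\<close>.\<close>

lemma monotone_order_diff:
  "monotone_order (Suc m) f \<Longrightarrow> monotone_order m (\<lambda>s. f s - f (s + 1))"
proof (induction m arbitrary: f)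
  case 0
  then show ?case
    using monotone_order_antimono[of 0 f] by simp
next
  case (Suc m)
  then obtain g where g: "\<forall>s\<ge>0. (f has_real_derivative - g s) (at s)" "monotone_order (Suc m) g"
    unfolding monotone_order.simps(2)[of "Suc m" f] by blast
  show ?case
  proof (rule monotone_order_SucI)
    fix s :: real assume s: "s \<ge> 0"
    show "0 \<le> f s - f (s + 1)"
      using monotone_order_antimono[OF Suc.prems, of s "s + 1"] s by simp
    have "((\<lambda>s. f (s + 1)) has_real_derivative - g (s + 1)) (at s)"
      using g s DERIV_shift[of f "- g (s + 1)" s 1] by simp
    with g s show "((\<lambda>s. f s - f (s + 1)) has_real_derivative - (g s - g (s + 1))) (at s)"
      by (auto intro!: derivative_eq_intros)
  qed (rule Suc.IH[OF g(2)])
qed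

text \<open>This is \<open>(-1) ^ k\<close> times the \<open>k\<close>-th forward difference of
  \<open>c\<close> at \<open>n\<close>.\<close>

primrec backward_diff :: "(nat \<Rightarrow> real) \<Rightarrow> nat \<Rightarrow> nat \<Rightarrow> real" where
  "backward_diff c 0 n = c n"
| "backward_diff c (Suc k) n = backward_diff c k n - backward_diff c k (Suc n)"

text \<open>Here the innermost difference is split off instead of the outermost, so that an
  induction can replace \<open>f s\<close> by \<open>f s - f (s + 1)\<close>.\<close>

lemma backward_diff_Suc':
  "backward_diff c (Suc k) n = backward_diff (\<lambda>n. c n - c (Suc n)) k n"
  by (induction k arbitrary: n) simp_all

lemma backward_diff_nonneg:
  assumes "\<And>m. monotone_order m f"
  shows "0 \<le> backward_diff (\<lambda>n. f (real n)) k n"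
  using assms
proof (induction k arbitrary: f)
  case 0
  then show ?case
    using monotone_order_nonneg[of 0 f "real n"] by simp
next
  case (Suc k)
  have "0 \<le> backward_diff (\<lambda>n. f (real n) - f (real n + 1)) k n"
    by (rule Suc.IH) (intro monotone_order_diff Suc.prems)
  then show ?case
    unfolding backward_diff_Suc' by (simp add: add.commute)
qed

text \<open>Order 0 is excluded because \<open>Digamma\<close> changes sign on the positive
  reals.\<close>

lemma Polygamma_sign:
  assumes "(x::real) > 0" "m > 0"
  shows "0 \<le> (-1) ^ Suc m * Polygamma m x"
proof (cases "even m")
  case True
  then show ?thesis
    using Polygamma_real_even_neg[of x m] assms by simp
next
  case False
  then show ?thesis
    using Polygamma_real_odd_pos[of x m] assms
    by (force elim!: nonpos_Ints_cases simp: less_imp_le)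
qed

text \<open>The function \<open>(-1) ^ Suc m * Polygamma m x\<close> is decreasing and convex for
  \<open>x > 0\<close>, also when \<open>m = 0\<close>, since only its first two derivatives need a
  sign.\<close>

lemma weak_supermajorized_Polygamma:
  assumes "weak_supermajorized q b a"
  shows "0 \<le> (-1) ^ Suc m * (\<Sum>i=1..q. Polygamma m (a i) - Polygamma m (b i))"
proof -
  have "(\<Sum>i=1..q. (-1) ^ Suc m * Polygamma m (b i)) \<le> (\<Sum>i=1..q. (-1) ^ Suc m * Polygamma m (a i))"
  proof (rule weak_supermajorized_sum_le[OF assms])
    fix x :: real assume x: "x > 0"
    then have [simp]: "x \<notin> \<int>\<^sub>\<le>\<^sub>0"
      by (auto elim!: nonpos_Ints_cases)
    show "((\<lambda>x. (-1) ^ Suc m * Polygamma m x) has_real_derivative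
            (-1) ^ Suc m * Polygamma (Suc m) x) (at x)"
      and "((\<lambda>x. (-1) ^ Suc m * Polygamma (Suc m) x) has_real_derivative
            (-1) ^ Suc m * Polygamma (Suc (Suc m)) x) (at x)"
      by (auto intro!: derivative_eq_intros)
    show "(-1) ^ Suc m * Polygamma (Suc m) x \<le> 0" "0 \<le> (-1) ^ Suc m * Polygamma (Suc (Suc m)) x"
      using Polygamma_sign[OF x, of "Suc m"] Polygamma_sign[OF x, of "Suc (Suc m)"] by simp_all
  qed
  then show ?thesis
    by (simp add: sum_subtractf sum_negf right_diff_distrib flip: sum_distrib_left)
qed

definition Gamma_quotient :: "nat \<Rightarrow> (nat \<Rightarrow> real) \<Rightarrow> (nat \<Rightarrow> real) \<Rightarrow> real \<Rightarrow> real" where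
  "Gamma_quotient q a b s = (\<Prod>i=1..q. Gamma (a i + s) / Gamma (b i + s))"

lemma monotone_order_Gamma_quotient:
  assumes ab: "weak_supermajorized q b a"
  shows "monotone_order m (Gamma_quotient q a b)"
proof -
  note pos = weak_supermajorized_pos[OF ab]
  \<comment> \<open>\<open>\<phi> 0\<close> is minus the logarithmic derivative of the Gamma
    quotient, and \<open>\<phi> j\<close> is \<open>(-1) ^ j\<close> times the \<open>j\<close>-th
    derivative of \<open>\<phi> 0\<close>.\<close>
  define \<phi> where "\<phi> j s = (-1) ^ Suc j * (\<Sum>i=1..q. Polygamma j (a i + s) - Polygamma j (b i + s))"
    for j s
  have notin: "a i + s \<notin> \<int>\<^sub>\<le>\<^sub>0" "b i + s \<notin> \<int>\<^sub>\<le>\<^sub>0" if "i \<in> {1..q}" "s \<ge> 0" for i s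
    using pos[OF that(1)] that(2) by (auto elim!: nonpos_Ints_cases)
  have \<phi>_nonneg: "0 \<le> \<phi> j s" if "s \<ge> 0" for j s
    unfolding \<phi>_def using ab that
    by (intro weak_supermajorized_Polygamma weak_supermajorized_shift)
       (auto simp: weak_supermajorized_def)
  have \<phi>_deriv: "(\<phi> j has_real_derivative - \<phi> (Suc j) s) (at s)" if "s \<ge> 0" for j s
    unfolding \<phi>_def using notin that
    by (auto intro!: derivative_eq_intros sum.cong simp: sum_distrib_left sum_subtractf sum_negf)
  have \<phi>_mono: "monotone_order m (\<phi> j)" for m j
  proof (induction m arbitrary: j)
    case (Suc m)
    then show ?case
      using \<phi>_nonneg \<phi>_deriv by (auto intro!: exI[of _ "\<phi> (Suc j)"])
  qed (auto simp: \<phi>_nonneg)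
  have nonneg: "0 \<le> Gamma_quotient q a b s" if "s \<ge> 0" for s
    unfolding Gamma_quotient_def using that
    by (intro prod_nonneg divide_nonneg_nonneg less_imp_le[OF Gamma_real_pos])
       (use pos in \<open>auto intro!: add_pos_nonneg\<close>)
  have deriv: "(Gamma_quotient q a b has_real_derivative - (Gamma_quotient q a b s * \<phi> 0 s)) (at s)"
    if s: "s \<ge> 0" for s
  proof -
    have nz: "Gamma (a i + s) \<noteq> 0" "Gamma (b i + s) \<noteq> 0" if "i \<in> {1..q}" for i
      using notin[OF that s] by (simp_all add: Gamma_eq_zero_iff)
    have quotient: "((\<lambda>s. Gamma (a i + s) / Gamma (b i + s)) has_real_derivative
        Gamma (a i + s) / Gamma (b i + s) * (Digamma (a i + s) - Digamma (b i + s))) (at s)"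
      if "i \<in> {1..q}" for i
      using notin[OF that s] nz[OF that]
      by (auto intro!: derivative_eq_intros simp: field_simps)
    have "(Gamma_quotient q a b has_real_derivative
        (\<Sum>i=1..q. Gamma (a i + s) / Gamma (b i + s) * (Digamma (a i + s) - Digamma (b i + s)) *
          (\<Prod>j\<in>{1..q} - {i}. Gamma (a j + s) / Gamma (b j + s)))) (at s)"
      unfolding Gamma_quotient_def[abs_def] by (intro has_field_derivative_prod quotient) auto
    also have "(\<Sum>i=1..q. Gamma (a i + s) / Gamma (b i + s) * (Digamma (a i + s) - Digamma (b i + s)) *
          (\<Prod>j\<in>{1..q} - {i}. Gamma (a j + s) / Gamma (b j + s))) =
        (\<Sum>i=1..q. Gamma_quotient q a b s * (Digamma (a i + s) - Digamma (b i + s)))"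
    proof (rule sum.cong)
      fix i assume "i \<in> {1..q}"
      then have "Gamma_quotient q a b s = Gamma (a i + s) / Gamma (b i + s) *
          (\<Prod>j\<in>{1..q} - {i}. Gamma (a j + s) / Gamma (b j + s))"
        unfolding Gamma_quotient_def by (intro prod.remove) auto
      then show "Gamma (a i + s) / Gamma (b i + s) * (Digamma (a i + s) - Digamma (b i + s)) *
          (\<Prod>j\<in>{1..q} - {i}. Gamma (a j + s) / Gamma (b j + s)) =
          Gamma_quotient q a b s * (Digamma (a i + s) - Digamma (b i + s))"
        by (simp only: mult_ac)
    qed simp
    finally show ?thesis
      by (simp add: \<phi>_def sum_distrib_left[symmetric])
  qed
  show ?thesis
  proof (induction m)
    case (Suc m)
    \<comment> \<open>\<open>- f' = f * \<phi> 0\<close>, so order \<open>m\<close> of \<open>f\<close> itself gives order \<open>m\<close> of \<open>- f'\<close>\<close>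
    have "monotone_order m (\<lambda>s. Gamma_quotient q a b s * \<phi> 0 s)"
      by (intro monotone_order_mult Suc.IH \<phi>_mono)
    then show ?case
      using nonneg deriv by (auto intro!: exI[of _ "\<lambda>s. Gamma_quotient q a b s * \<phi> 0 s"])
  qed (auto simp: nonneg)
qed

section \<open>Pochhammer quotients as Gamma quotients at the integers\<close>

definition pochhammer_quotient :: "nat \<Rightarrow> (nat \<Rightarrow> real) \<Rightarrow> (nat \<Rightarrow> real) \<Rightarrow> nat \<Rightarrow> real" where
  "pochhammer_quotient q a b n = (\<Prod>i=1..q. pochhammer (a i) n / pochhammer (b i) n)"

lemma backward_diff_cmult:
  "backward_diff (\<lambda>n. r * c n) k n = r * backward_diff c k n"
  by (induction k arbitrary: n) (simp_all add: algebra_simps)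

lemma backward_diff_pochhammer_quotient_nonneg:
  assumes ab: "weak_supermajorized q b a"
  shows "0 \<le> backward_diff (pochhammer_quotient q a b) k n"
proof -
  note pos = weak_supermajorized_pos[OF ab]
  have eq: "pochhammer_quotient q a b =
      (\<lambda>n. 1 / Gamma_quotient q a b 0 * Gamma_quotient q a b (real n))"
  proof
    fix n
    have "pochhammer_quotient q a b n =
        (\<Prod>i=1..q. (Gamma (a i + real n) / Gamma (b i + real n)) / (Gamma (a i) / Gamma (b i)))"
      unfolding pochhammer_quotient_def
    proof (rule prod.cong)
      fix i assume "i \<in> {1..q}"
      then have "a i \<notin> \<int>\<^sub>\<le>\<^sub>0" "b i \<notin> \<int>\<^sub>\<le>\<^sub>0"
        using pos[of i] by (auto elim!: nonpos_Ints_cases)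
      then show "pochhammer (a i) n / pochhammer (b i) n =
          (Gamma (a i + real n) / Gamma (b i + real n)) / (Gamma (a i) / Gamma (b i))"
        by (simp add: pochhammer_Gamma)
    qed simp
    then show "pochhammer_quotient q a b n =
        1 / Gamma_quotient q a b 0 * Gamma_quotient q a b (real n)"
      by (simp add: Gamma_quotient_def prod_dividef prod.distrib mult_ac)
  qed
  have "0 \<le> Gamma_quotient q a b 0"
    using monotone_order_Gamma_quotient[OF ab] by (rule monotone_order_nonneg) simp
  then show ?thesis
    using backward_diff_nonneg[OF monotone_order_Gamma_quotient[OF ab], of k n]
      backward_diff_cmult[of "1 / Gamma_quotient q a b 0" "\<lambda>n. Gamma_quotient q a b (real n)" k n]
    by (simp add: eq)
qed

subsection \<open>Discrete solutions of the Hausdorff moment problem\<close>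

text \<open>If \<open>L\<close> is the functional with \<open>L (t\<^sup>n) = c n\<close>, then \<open>backward_diff c k n = L (t\<^sup>n (1 - t)\<^sup>k)\<close>,
  and \<open>bernstein_weight c N k\<close> is \<open>L\<close> of the \<open>k\<close>-th Bernstein polynomial of degree \<open>N\<close>,
  regarded as a mass at the point \<open>k / N\<close> (which is \<open>0\<close> for \<open>N = 0\<close>).\<close>

definition bernstein_weight :: "(nat \<Rightarrow> real) \<Rightarrow> nat \<Rightarrow> nat \<Rightarrow> real" where
  "bernstein_weight c N k = real (N choose k) * backward_diff c (N - k) k"

definition bernstein_moment :: "(nat \<Rightarrow> real) \<Rightarrow> nat \<Rightarrow> nat \<Rightarrow> real" where
  "bernstein_moment c N j = (\<Sum>k\<le>N. bernstein_weight c N k * (real k / real N) ^ j)"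

text \<open>In terms of the functional \<open>L\<close> this expands
  \<open>L (t ^ j * (t + (1 - t)) ^ M)\<close> by the binomial theorem; the induction uses Pascal's
  rule.\<close>

lemma sum_choose_backward_diff:
  "(\<Sum>k\<le>M. real (M choose k) * backward_diff c (M - k) (j + k)) = c j"
proof (induction M arbitrary: j)
  case (Suc M)
  let ?B = "backward_diff c"
  \<comment> \<open>The term with \<open>k = Suc M\<close> is zero, so the sum can run to
    \<open>Suc M\<close> for the index shift and to \<open>M\<close> afterwards.\<close>
  have "(\<Sum>k\<le>Suc M. real (M choose k) * ?B (Suc M - k) (j + k)) =
      ?B (Suc M) j + (\<Sum>k\<le>M. real (M choose Suc k) * ?B (M - k) (j + Suc k))"
    by (subst sum.atMost_Suc_shift) simp
  then have top: "(\<Sum>k\<le>M. real (M choose Suc k) * ?B (M - k) (j + Suc k)) =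
      (\<Sum>k\<le>M. real (M choose k) * ?B (Suc M - k) (j + k)) - ?B (Suc M) j"
    by (simp add: binomial_eq_0)
  have "(\<Sum>k\<le>Suc M. real (Suc M choose k) * ?B (Suc M - k) (j + k)) =
      ?B (Suc M) j + (\<Sum>k\<le>M. real (Suc M choose Suc k) * ?B (M - k) (j + Suc k))"
    by (subst sum.atMost_Suc_shift) simp
  also have "\<dots> = (\<Sum>k\<le>M. real (M choose k) * ?B (M - k) (j + Suc k)) +
      (\<Sum>k\<le>M. real (M choose k) * ?B (Suc M - k) (j + k))"
    using top by (simp add: distrib_right sum.distrib del: backward_diff.simps)
  \<comment> \<open>The terms combine by the recursion \<open>?B (Suc (M - k)) (j + k) = ?B (M - k)
    (j + k) - ?B (M - k) (j + Suc k)\<close>.\<close>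
  also have "\<dots> = (\<Sum>k\<le>M. real (M choose k) * ?B (M - k) (j + k))"
    by (subst sum.distrib[symmetric], rule sum.cong) (auto simp: Suc_diff_le algebra_simps)
  finally show ?case
    by (simp only: Suc.IH)
qed simp

text \<open>The factorial moments of the discrete measures agree exactly with \<open>c\<close>; the power moments
  do so only in the limit.\<close>

lemma sum_bernstein_weight_choose:
  assumes "j \<le> N"
  shows "(\<Sum>k\<le>N. bernstein_weight c N k * real (k choose j)) = real (N choose j) * c j"
proof -
  have "(\<Sum>k\<le>N. bernstein_weight c N k * real (k choose j)) =
      (\<Sum>k\<in>{j..N}. bernstein_weight c N k * real (k choose j))"
    by (rule sum.mono_neutral_right) (auto simp: not_le)
  also have "\<dots> = (\<Sum>k\<in>{j..N}. real (N choose j) * (real ((N - j) choose (k - j)) * backward_diff c (N - k) k))"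
  proof (rule sum.cong)
    fix k assume "k \<in> {j..N}"
    then have "(N choose k) * (k choose j) = (N choose j) * ((N - j) choose (k - j))"
      by (intro choose_mult) auto
    then have "real (N choose k) * real (k choose j) = real (N choose j) * real ((N - j) choose (k - j))"
      by (metis of_nat_mult)
    then show "bernstein_weight c N k * real (k choose j) =
        real (N choose j) * (real ((N - j) choose (k - j)) * backward_diff c (N - k) k)"
      unfolding bernstein_weight_def by (metis mult.assoc mult.commute)
  qed simp
  also have "\<dots> = real (N choose j) *
      (\<Sum>k\<le>N - j. real ((N - j) choose k) * backward_diff c (N - j - k) (j + k))"
    unfolding sum_distrib_left
    by (rule sum.reindex_bij_witness[of _ "\<lambda>k. k + j" "\<lambda>k. k - j"]) (use assms in auto)
  finally show ?thesis
    by (simp only: sum_choose_backward_diff)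
qed

text \<open>Both quantities are products of \<open>j\<close> factors of modulus at most 1, so their
  distance is at most the sum of the distances of the factors.\<close>

lemma choose_quotient_power_diff:
  assumes "k \<le> N" and "2 * j \<le> N" and "N > 0"
  shows "\<bar>(real k / real N) ^ j - real (k choose j) / real (N choose j)\<bar> \<le> 2 * real j ^ 2 / real N"
proof -
  \<comment> \<open>For \<open>k < i\<close> the factor is negative; \<open>2 * j \<le> N\<close>
    keeps it above -1 and its denominator above \<open>N / 2\<close>.\<close>
  have le: "\<bar>(real k - real i) / (real N - real i)\<bar> \<le> 1"
    and diff: "\<bar>real k / real N - (real k - real i) / (real N - real i)\<bar> \<le> 2 * real j / real N"
    if "i \<in> {0..<j}" for i
  proof -
    have i: "real i < real j" "2 * real i < real N" "2 * real j \<le> real N" "real k \<le> real N"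
      using that assms by auto
    then show "\<bar>(real k - real i) / (real N - real i)\<bar> \<le> 1"
      by (auto simp: abs_le_iff)
    have "real k / real N - (real k - real i) / (real N - real i) =
        real i / (real N - real i) * ((real N - real k) / real N)"
      using i by (simp add: divide_simps) (simp add: algebra_simps)
    then have "\<bar>real k / real N - (real k - real i) / (real N - real i)\<bar> =
        real i / (real N - real i) * ((real N - real k) / real N)"
      using i by simp
    also have "\<dots> \<le> real j / (real N / 2) * 1"
      using i by (intro mult_mono frac_le) auto
    finally show "\<bar>real k / real N - (real k - real i) / (real N - real i)\<bar> \<le> 2 * real j / real N"
      by (simp add: mult.commute)
  qed
  have "real (k choose j) / real (N choose j) =
      (\<Prod>i\<in>{0..<j}. (real k - real i) / (real N - real i))"
    by (simp add: binomial_gbinomial gbinomial_prod_rev prod_dividef)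
  moreover have "(real k / real N) ^ j = (\<Prod>i\<in>{0..<j}. real k / real N)"
    by simp
  ultimately have "\<bar>(real k / real N) ^ j - real (k choose j) / real (N choose j)\<bar> \<le>
      (\<Sum>i\<in>{0..<j}. \<bar>real k / real N - (real k - real i) / (real N - real i)\<bar>)"
    using norm_prod_diff[of "{0..<j}" "\<lambda>_. real k / real N"
        "\<lambda>i. (real k - real i) / (real N - real i)"] le assms by simp
  also have "\<dots> \<le> (\<Sum>i\<in>{0..<j}. 2 * real j / real N)"
    by (intro sum_mono diff)
  finally show ?thesis
    by (simp add: power2_eq_square mult_ac)
qed

text \<open>By Hausdorff's theorem these are the moment sequences of the probability measures on
  [0, 1].\<close>

locale hausdorff_sequence =
  fixes c :: "nat \<Rightarrow> real"
  assumes diff_nonneg: "0 \<le> backward_diff c k n" and zeroth: "c 0 = 1"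
begin

lemma weight_nonneg: "0 \<le> bernstein_weight c N k"
  by (simp add: bernstein_weight_def diff_nonneg)

lemma sum_weight: "(\<Sum>k\<le>N. bernstein_weight c N k) = 1"
  using sum_bernstein_weight_choose[of 0 N c] by (simp add: zeroth)

lemma moment_nonneg: "0 \<le> bernstein_moment c N j"
  unfolding bernstein_moment_def by (intro sum_nonneg mult_nonneg_nonneg weight_nonneg) auto

lemma moment_le_1: "bernstein_moment c N j \<le> 1"
proof -
  have "bernstein_moment c N j \<le> (\<Sum>k\<le>N. bernstein_weight c N k * 1)"
    unfolding bernstein_moment_def
    by (intro sum_mono mult_left_mono weight_nonneg power_le_one) (auto simp: divide_le_eq_1)
  then show ?thesis
    by (simp add: sum_weight)
qed

text \<open>The normalised factorial moments equal \<open>c j\<close>, and replacing them by power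
  moments costs O(1/N) uniformly in \<open>k\<close>.\<close>

lemma moment_tendsto: "(\<lambda>N. bernstein_moment c N j) \<longlonglongrightarrow> c j"
proof (rule LIM_zero_cancel, rule Lim_null_comparison)
  show "\<forall>\<^sub>F N in sequentially. norm (bernstein_moment c N j - c j) \<le> 2 * real j ^ 2 / real N"
  proof (rule eventually_sequentiallyI)
    fix N assume "2 * j + 1 \<le> N"
    then have N: "2 * j \<le> N" "N > 0" "j \<le> N"
      by auto
    then have nz: "real (N choose j) \<noteq> 0"
      by simp
    have "c j = (\<Sum>k\<le>N. bernstein_weight c N k * real (k choose j)) / real (N choose j)"
      using sum_bernstein_weight_choose[OF N(3), of c] nz by simp
    then have "bernstein_moment c N j - c j = (\<Sum>k\<le>N. bernstein_weight c N k *
        ((real k / real N) ^ j - real (k choose j) / real (N choose j)))"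
      by (simp add: bernstein_moment_def sum_divide_distrib sum_subtractf right_diff_distrib)
    also have "norm \<dots> \<le> (\<Sum>k\<le>N. norm (bernstein_weight c N k *
        ((real k / real N) ^ j - real (k choose j) / real (N choose j))))"
      by (rule norm_sum)
    also have "\<dots> \<le> (\<Sum>k\<le>N. bernstein_weight c N k * (2 * real j ^ 2 / real N))"
    proof (rule sum_mono)
      fix k assume "k \<in> {..N}"
      then show "norm (bernstein_weight c N k *
          ((real k / real N) ^ j - real (k choose j) / real (N choose j))) \<le>
          bernstein_weight c N k * (2 * real j ^ 2 / real N)"
        using choose_quotient_power_diff[of k N j] N weight_nonneg[of N k]
        by (simp add: abs_mult mult_left_mono del: times_divide_eq_right)
    qed
    also have "\<dots> = 2 * real j ^ 2 / real N"
      by (simp only: sum_distrib_right[symmetric] sum_weight mult_1)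
    finally show "norm (bernstein_moment c N j - c j) \<le> 2 * real j ^ 2 / real N" .
  qed
  show "(\<lambda>N. 2 * real j ^ 2 / real N) \<longlonglongrightarrow> 0"
    by (rule lim_const_over_n)
qed

lemma first_le_1: "c 1 \<le> 1"
  using moment_tendsto[of 1] moment_le_1[of _ 1] by (intro LIMSEQ_le_const2) auto

end

subsection \<open>The analytic continuation\<close>

text \<open>This keeps the base of the power in \<open>binomial_kernel\<close> off the branch cut of
  \<open>powr\<close>.\<close>

lemma cut_plane_one_minus_notin:
  assumes "z \<in> cut_plane" and "0 \<le> t" "t \<le> 1"
  shows "1 - z * of_real t \<notin> \<real>\<^sub>\<le>\<^sub>0"
proof
  assume "1 - z * of_real t \<in> \<real>\<^sub>\<le>\<^sub>0"
  then obtain r where r: "1 - z * of_real t = of_real r" "r \<le> 0"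
    by (auto elim: nonpos_Reals_cases)
  then have zt: "z * of_real t = of_real (1 - r)"
    by (simp add: algebra_simps)
  with r have "t \<noteq> 0"
    by auto
  with zt have "z = of_real ((1 - r) / t)"
    by (simp add: field_simps)
  moreover have "(1 - r) / t \<ge> 1"
    using assms r \<open>t \<noteq> 0\<close> by (simp add: field_simps)
  ultimately show False
    using assms(1) unfolding cut_plane_def by blast
qed

text \<open>The factor \<open>t\<close> raises the moment index by one, which produces
  \<open>c (Suc n)\<close> and thus the passage from \<alpha>, \<beta> to \<open>a\<close>,
  \<open>b\<close>.\<close>

definition binomial_kernel :: "real \<Rightarrow> complex \<Rightarrow> real \<Rightarrow> complex" where
  "binomial_kernel \<sigma> z t = of_real t * (1 - z * of_real t) powr (- of_real \<sigma>)"

lemma binomial_kernel_holomorphic: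
  assumes "0 \<le> t" "t \<le> 1"
  shows "(\<lambda>z. binomial_kernel \<sigma> z t) holomorphic_on cut_plane"
  unfolding binomial_kernel_def using cut_plane_one_minus_notin[OF _ assms]
  by (intro holomorphic_intros) auto

text \<open>Uniformity in \<open>t\<close> carries the bound over to all the discrete means, as
  Montel's theorem requires.\<close>

lemma binomial_kernel_bounded:
  assumes K: "compact K" "K \<subseteq> cut_plane" and "0 \<le> \<sigma>"
  shows "\<exists>B. \<forall>z\<in>K. \<forall>t\<in>{0..1}. norm (binomial_kernel \<sigma> z t) \<le> B"
proof (cases "K = {}")
  case False
  have "compact (K \<times> {0..1::real})"
    using K by (intro compact_Times) auto
  moreover have "continuous_on (K \<times> {0..1::real}) (\<lambda>(z, t). norm (1 - z * of_real t))"
    unfolding case_prod_unfold by (intro continuous_intros)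
  ultimately obtain p where p: "p \<in> K \<times> {0..1::real}"
      "\<And>r. r \<in> K \<times> {0..1::real} \<Longrightarrow>
        (\<lambda>(z, t). norm (1 - z * of_real t)) p \<le> (\<lambda>(z, t). norm (1 - z * of_real t)) r"
    using False continuous_attains_inf[of "K \<times> {0..1::real}" "\<lambda>(z, t). norm (1 - z * of_real t)"]
    by auto
  \<comment> \<open>The minimum of \<open>norm (1 - z * of_real t)\<close> over the compact product,
    positive because the minimiser avoids the branch cut.\<close>
  define \<delta> where "\<delta> = norm (1 - fst p * of_real (snd p))"
  have "1 - fst p * of_real (snd p) \<notin> \<real>\<^sub>\<le>\<^sub>0"
    using p(1) K by (intro cut_plane_one_minus_notin) auto
  then have "\<delta> > 0"
    unfolding \<delta>_def by (metis nonpos_Reals_zero_I zero_less_norm_iff)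
  have "norm (binomial_kernel \<sigma> z t) \<le> \<delta> powr (- \<sigma>)" if "z \<in> K" "t \<in> {0..1}" for z t
  proof -
    have "\<delta> \<le> norm (1 - z * of_real t)"
      using p(2)[of "(z, t)"] that by (simp add: \<delta>_def case_prod_unfold)
    then have "norm (1 - z * of_real t) powr (- \<sigma>) \<le> \<delta> powr (- \<sigma>)"
      using \<open>\<delta> > 0\<close> \<open>0 \<le> \<sigma>\<close> by (intro powr_mono2') auto
    moreover have "norm (binomial_kernel \<sigma> z t) = t * norm (1 - z * of_real t) powr (- \<sigma>)"
      using that by (simp add: binomial_kernel_def norm_mult norm_powr_real_powr')
    moreover have "t * norm (1 - z * of_real t) powr (- \<sigma>) \<le> 1 * norm (1 - z * of_real t) powr (- \<sigma>)"
      using that by (intro mult_right_mono) auto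
    ultimately show ?thesis
      by simp
  qed
  then show ?thesis
    by blast
qed auto

lemma binomial_kernel_sums:
  assumes "norm z < 1" and "0 \<le> t" "t \<le> 1"
  shows "(\<lambda>n. of_real (pochhammer \<sigma> n / fact n) * of_real (t ^ Suc n) * z ^ n) sums
    binomial_kernel \<sigma> z t"
proof -
  have "norm (- (z * of_real t)) \<le> norm z * 1"
    unfolding norm_minus_cancel norm_mult using assms by (intro mult_left_mono) auto
  with assms have "norm (- (z * of_real t)) < 1"
    by simp
  from sums_mult[OF gen_binomial_complex[OF this, of "- of_real \<sigma>"], of "of_real t"]
  have "(\<lambda>n. of_real t * ((- of_real \<sigma> gchoose n) * (- (z * of_real t)) ^ n)) sums
      binomial_kernel \<sigma> z t"
    by (simp add: binomial_kernel_def)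
  moreover have "of_real t * ((- of_real \<sigma> gchoose n) * (- (z * of_real t)) ^ n) =
      of_real (pochhammer \<sigma> n / fact n) * of_real (t ^ Suc n) * z ^ n" for n
  proof -
    have "(-1) ^ n * (-1) ^ n = (1 :: complex)"
      by (simp flip: power_add)
    then show ?thesis
      by (simp add: gbinomial_pochhammer power_minus[of "z * of_real t"] power_mult_distrib
          pochhammer_of_real mult_ac)
  qed
  ultimately show ?thesis
    by simp
qed

text \<open>The binomial coefficients are thus bounded by 1, so a geometric series dominates in the
  unit disc.\<close>

lemma abs_pochhammer_le_fact:
  assumes "0 \<le> \<sigma>" "\<sigma> \<le> (1::real)"
  shows "\<bar>pochhammer \<sigma> n\<bar> \<le> fact n"
proof (induction n)
  case (Suc n)
  have "\<bar>pochhammer \<sigma> (Suc n)\<bar> = \<bar>pochhammer \<sigma> n\<bar> * (\<sigma> + real n)"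
    using assms by (simp add: pochhammer_Suc abs_mult)
  also have "\<dots> \<le> fact n * (1 + real n)"
    using assms by (intro mult_mono Suc.IH) auto
  finally show ?case
    by (simp add: mult.commute)
qed simp

section \<open>Kernel means over the discrete measures\<close>

context hausdorff_sequence
begin

definition kernel_mean :: "real \<Rightarrow> nat \<Rightarrow> complex \<Rightarrow> complex" where
  "kernel_mean \<sigma> N z =
     (\<Sum>k\<le>N. of_real (bernstein_weight c N k) * binomial_kernel \<sigma> z (real k / real N))"

lemma kernel_mean_holomorphic: "kernel_mean \<sigma> N holomorphic_on cut_plane"
  unfolding kernel_mean_def[abs_def]
  by (intro holomorphic_intros binomial_kernel_holomorphic) (auto simp: divide_le_eq_1)

lemma kernel_mean_bounded:
  assumes "compact K" "K \<subseteq> cut_plane" and "0 \<le> \<sigma>"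
  shows "\<exists>B. \<forall>N. \<forall>z\<in>K. norm (kernel_mean \<sigma> N z) \<le> B"
proof -
  obtain B where B: "\<And>z t. z \<in> K \<Longrightarrow> t \<in> {0..1} \<Longrightarrow> norm (binomial_kernel \<sigma> z t) \<le> B"
    using binomial_kernel_bounded[OF assms] by blast
  have "norm (kernel_mean \<sigma> N z) \<le> B" if z: "z \<in> K" for N z
  proof -
    have "norm (kernel_mean \<sigma> N z) \<le>
        (\<Sum>k\<le>N. norm (of_real (bernstein_weight c N k) * binomial_kernel \<sigma> z (real k / real N)))"
      unfolding kernel_mean_def by (rule norm_sum)
    also have "\<dots> \<le> (\<Sum>k\<le>N. bernstein_weight c N k * B)"
      using weight_nonneg z
      by (intro sum_mono) (auto simp: norm_mult divide_le_eq_1 intro!: mult_left_mono B)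
    also have "\<dots> = B"
      by (simp flip: sum_distrib_right add: sum_weight)
    finally show ?thesis .
  qed
  then show ?thesis
    by blast
qed

text \<open>Tannery's theorem exchanges the limit in \<open>N\<close> with the power series, since
  the moments converge termwise and \<open>norm z ^ n\<close> dominates.\<close>

lemma kernel_mean_tendsto:
  assumes \<sigma>: "0 \<le> \<sigma>" "\<sigma> \<le> 1" and z: "norm z < 1"
  shows "summable (\<lambda>n. of_real (pochhammer \<sigma> n / fact n) * of_real (c (Suc n)) * z ^ n)" (is ?A)
    and "(\<lambda>N. kernel_mean \<sigma> N z) \<longlonglongrightarrow>
      (\<Sum>n. of_real (pochhammer \<sigma> n / fact n) * of_real (c (Suc n)) * z ^ n)" (is ?B)
proof -
  define u where "u n N = of_real (pochhammer \<sigma> n / fact n) *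
    of_real (bernstein_moment c N (Suc n)) * z ^ n" for n N
  have "u n N = (\<Sum>k\<le>N. of_real (bernstein_weight c N k) * (of_real (pochhammer \<sigma> n / fact n) *
      of_real ((real k / real N) ^ Suc n) * z ^ n))" for n N
    by (simp add: u_def bernstein_moment_def sum_distrib_left sum_distrib_right mult_ac)
  moreover have "(\<lambda>n. \<Sum>k\<le>N. of_real (bernstein_weight c N k) * (of_real (pochhammer \<sigma> n / fact n) *
      of_real ((real k / real N) ^ Suc n) * z ^ n)) sums kernel_mean \<sigma> N z" for N
    unfolding kernel_mean_def
    by (intro sums_sum sums_mult binomial_kernel_sums z) (auto simp: divide_le_eq_1)
  ultimately have suminf: "suminf (\<lambda>n. u n N) = kernel_mean \<sigma> N z" for N
    by (simp add: sums_iff)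
  have limit: "(\<lambda>N. u n N) \<longlonglongrightarrow> of_real (pochhammer \<sigma> n / fact n) * of_real (c (Suc n)) * z ^ n" for n
    unfolding u_def by (intro tendsto_intros moment_tendsto)
  have bound: "norm (u n N) \<le> norm z ^ n" for n N
  proof -
    have "norm (u n N) = \<bar>pochhammer \<sigma> n / fact n\<bar> * bernstein_moment c N (Suc n) * norm z ^ n"
      by (simp add: u_def norm_mult norm_power moment_nonneg del: of_real_divide)
    also have "\<dots> \<le> 1 * 1 * norm z ^ n"
      using abs_pochhammer_le_fact[OF \<sigma>, of n] moment_le_1
      by (intro mult_mono) (auto simp: moment_nonneg)
    finally show ?thesis
      by simp
  qed
  have "summable (\<lambda>n. norm z ^ n)"
    using z by (simp add: summable_geometric)
  moreover have "\<forall>\<^sub>F (n, N) in at_top \<times>\<^sub>F sequentially. norm (u n N) \<le> norm z ^ n"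
    by (intro always_eventually) (auto simp: bound)
  ultimately have tannery:
    "summable (\<lambda>n. norm (of_real (pochhammer \<sigma> n / fact n) * of_real (c (Suc n)) * z ^ n)) \<and>
     (\<lambda>N. suminf (\<lambda>n. u n N)) \<longlonglongrightarrow>
       (\<Sum>n. of_real (pochhammer \<sigma> n / fact n) * of_real (c (Suc n)) * z ^ n)"
    by (intro conjunct2[OF tannerys_theorem[of u, OF limit _ _ sequentially_bot]])
  from tannery[THEN conjunct2] show ?B
    by (simp only: suminf)
  from tannery[THEN conjunct1] show ?A
    by (rule summable_norm_cancel)
qed

text \<open>On the unit disc the full sequence converges to the power series, which identifies the
  limit of whichever subsequence Montel's theorem selects.\<close>

lemma kernel_mean_limit:
  assumes \<sigma>: "0 \<le> \<sigma>" "\<sigma> \<le> 1"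
  obtains F r where "F holomorphic_on cut_plane" and "strict_mono (r :: nat \<Rightarrow> nat)"
    and "\<And>z. z \<in> cut_plane \<Longrightarrow> (\<lambda>n. kernel_mean \<sigma> (r n) z) \<longlonglongrightarrow> F z"
    and "\<And>z. norm z < 1 \<Longrightarrow>
      (\<lambda>n. of_real (pochhammer \<sigma> n / fact n) * of_real (c (Suc n)) * z ^ n) sums F z"
proof -
  obtain F r where F: "F holomorphic_on cut_plane" "strict_mono (r :: nat \<Rightarrow> nat)"
      "\<And>z. z \<in> cut_plane \<Longrightarrow> (\<lambda>n. kernel_mean \<sigma> (r n) z) \<longlonglongrightarrow> F z"
  proof (rule Montel[of cut_plane "range (kernel_mean \<sigma>)" "kernel_mean \<sigma>"])
    show "\<exists>B. \<forall>h\<in>range (kernel_mean \<sigma>). \<forall>z\<in>K. norm (h z) \<le> B"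
      if "compact K" "K \<subseteq> cut_plane" for K
      using kernel_mean_bounded[OF that \<sigma>(1)] by auto
  qed (use open_cut_plane kernel_mean_holomorphic in auto)
  have "(\<lambda>n. of_real (pochhammer \<sigma> n / fact n) * of_real (c (Suc n)) * z ^ n) sums F z"
    if z: "norm z < 1" for z
  proof -
    have "z \<in> cut_plane"
      using z ball_subset_cut_plane by auto
    moreover have "(\<lambda>n. kernel_mean \<sigma> (r n) z) \<longlonglongrightarrow>
        (\<Sum>n. of_real (pochhammer \<sigma> n / fact n) * of_real (c (Suc n)) * z ^ n)"
      using LIMSEQ_subseq_LIMSEQ[OF kernel_mean_tendsto(2)[OF \<sigma> z] F(2)] by (simp add: o_def)
    ultimately have "F z = (\<Sum>n. of_real (pochhammer \<sigma> n / fact n) * of_real (c (Suc n)) * z ^ n)"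
      by (intro LIMSEQ_unique[OF F(3)])
    then show ?thesis
      using summable_sums[OF kernel_mean_tendsto(1)[OF \<sigma> z]] by (simp only:)
  qed
  with F show ?thesis
    by (rule that)
qed

end

subsection \<open>The strict inequality\<close>

text \<open>The quadratic term quantifies strict concavity, so that strictness survives the passage to
  the limit.\<close>

lemma real_binomial_kernel_tangent:
  fixes x \<sigma> m :: real
  assumes x: "x > 0" and \<sigma>: "0 < \<sigma>" "\<sigma> \<le> 1" and m: "0 < m" "m \<le> 1"
  obtains d \<kappa> where "\<kappa> > 0"
    and "\<And>t. t \<in> {0..1} \<Longrightarrow> t * (1 + x * t) powr (- \<sigma>) \<le>
      m * (1 + x * m) powr (- \<sigma>) + d * (t - m) - \<kappa> * (t - m)\<^sup>2"
proof -
  \<comment> \<open>\<open>2 * \<kappa>\<close> bounds minus the second derivative of the kernel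
    from below on \<open>C\<close>.\<close>
  define \<kappa> where "\<kappa> = \<sigma> * x * (1 + 2 * x) powr (- \<sigma> - 2) / 2"
  \<comment> \<open>An open interval around [0, 1], so that even \<open>m = 1\<close> is interior;
    its left end keeps \<open>1 + x * t\<close> positive.\<close>
  define C where "C = {- 1 / x<..<2}"
  define h where "h t = - (t * (1 + x * t) powr (- \<sigma>)) - \<kappa> * t\<^sup>2" for t
  define h' where "h' t = - ((1 + x * t) powr (- \<sigma>)) + \<sigma> * x * t * (1 + x * t) powr (- \<sigma> - 1) -
    2 * \<kappa> * t" for t
  define h'' where "h'' t = 2 * \<sigma> * x * (1 + x * t) powr (- \<sigma> - 1) -
    \<sigma> * (\<sigma> + 1) * x\<^sup>2 * t * (1 + x * t) powr (- \<sigma> - 2) - 2 * \<kappa>" for t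
  have \<kappa>: "\<kappa> > 0"
    using x \<sigma> by (simp add: \<kappa>_def)
  have pos: "1 + x * t > 0" if "t \<in> C" for t
    using that x by (auto simp: C_def field_simps)
  have deriv: "(h has_real_derivative h' t) (at t)" if "t \<in> C" for t
    unfolding h_def[abs_def] h'_def using pos[OF that]
    by (auto intro!: derivative_eq_intros simp: algebra_simps)
  have deriv': "(h' has_real_derivative h'' t) (at t)" if "t \<in> C" for t
    unfolding h'_def[abs_def] h''_def using pos[OF that]
    by (auto intro!: derivative_eq_intros simp: algebra_simps power2_eq_square)
  have "h'' t \<ge> 0" if "t \<in> C" for t
  proof -
    define u where "u = 1 + x * t"
    have u: "0 < u" "u \<le> 1 + 2 * x"
      using pos[OF that] that x by (auto simp: u_def C_def mult_le_cancel_left)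
    have "- \<sigma> - 1 = 1 + (- \<sigma> - 2)"
      by simp
    then have "u powr (- \<sigma> - 1) = u * u powr (- \<sigma> - 2)"
      using u by (metis powr_mult_base less_imp_le)
    \<comment> \<open>Substituting \<open>x * t = u - 1\<close> collects both terms over one power
      of \<open>u\<close>; the remaining factor is at least 1 because
      \<open>\<sigma> \<le> 1\<close>.\<close>
    then have "h'' t = \<sigma> * x * (u powr (- \<sigma> - 2) * ((1 - \<sigma>) * u + \<sigma> + 1)) - 2 * \<kappa>"
      unfolding h''_def u_def[symmetric]
      by (simp add: algebra_simps power2_eq_square) (simp add: u_def algebra_simps)
    moreover have "(1 + 2 * x) powr (- \<sigma> - 2) * 1 \<le> u powr (- \<sigma> - 2) * ((1 - \<sigma>) * u + \<sigma> + 1)"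
    proof (intro mult_mono)
      show "(1 + 2 * x) powr (- \<sigma> - 2) \<le> u powr (- \<sigma> - 2)"
        using u \<sigma> by (intro powr_mono2') auto
      have "0 \<le> (1 - \<sigma>) * u"
        using u \<sigma> by (intro mult_nonneg_nonneg) auto
      then show "1 \<le> (1 - \<sigma>) * u + \<sigma> + 1"
        using \<sigma> by simp
    qed auto
    then have "\<sigma> * x * ((1 + 2 * x) powr (- \<sigma> - 2) * 1) \<le>
        \<sigma> * x * (u powr (- \<sigma> - 2) * ((1 - \<sigma>) * u + \<sigma> + 1))"
      using x \<sigma> by (intro mult_left_mono) auto
    ultimately show ?thesis
      by (simp add: \<kappa>_def)
  qed
  then have convex: "convex_on C h"
    using deriv deriv' by (intro f''_ge0_imp_convex[of C h h' h'']) (auto simp: C_def)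
  have tangent: "h' m * (t - m) \<le> h t - h m" if "t \<in> {0..1}" for t
  proof (rule convex_on_imp_above_tangent[OF convex])
    have "- 1 / x < m" "- 1 / x < t"
      using x m that by (auto intro: less_le_trans[of _ 0] order_less_trans[of _ 0])
    then show "m \<in> interior C" "t \<in> C"
      using m that by (auto simp: C_def interior_open)
    then show "(h has_real_derivative h' m) (at m within C)"
      using deriv interior_subset by (blast intro: has_field_derivative_at_within)
  qed (simp add: C_def)
  show ?thesis
  proof (rule that[OF \<kappa>])
    fix t :: real assume "t \<in> {0..1}"
    \<comment> \<open>The linear coefficient arises from
      \<open>t^2 - m^2 = (t - m)^2 + 2 * m * (t - m)\<close>; it is the derivative of the kernel at
      \<open>m\<close>.\<close>
    from tangent[OF this] show "t * (1 + x * t) powr (- \<sigma>) \<le>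
        m * (1 + x * m) powr (- \<sigma>) + (- h' m - 2 * \<kappa> * m) * (t - m) - \<kappa> * (t - m)\<^sup>2"
      by (simp add: h_def power2_eq_square algebra_simps)
  qed
qed

section \<open>Jensen's inequality in the limit\<close>

context hausdorff_sequence
begin

lemma kernel_mean_neg_real:
  assumes "x > 0"
  shows "kernel_mean \<sigma> N (of_real (- x)) = of_real (\<Sum>k\<le>N. bernstein_weight c N k *
    (real k / real N * (1 + x * (real k / real N)) powr (- \<sigma>)))"
proof -
  have "binomial_kernel \<sigma> (of_real (- x)) t = of_real (t * (1 + x * t) powr (- \<sigma>))"
    if "t \<ge> 0" for t
  proof -
    have "1 - of_real (- x) * of_real t = complex_of_real (1 + x * t)"
      by simp
    moreover have "0 \<le> 1 + x * t"
      using assms that by simp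
    ultimately show ?thesis
      unfolding binomial_kernel_def
      by (simp only: powr_of_real of_real_minus[symmetric] of_real_mult)
  qed
  then show ?thesis
    by (simp add: kernel_mean_def del: of_real_minus)
qed

text \<open>The quadratic tangent bound at the mean \<open>c 1\<close> is averaged over the weights.
  In the limit its linear term vanishes and its quadratic term becomes \<kappa> times the
  variance.\<close>

lemma kernel_mean_limit_less:
  assumes x: "x > 0" and \<sigma>: "0 < \<sigma>" "\<sigma> \<le> 1"
    and c1: "0 < c 1" and c2: "(c 1)\<^sup>2 < c 2"
    and "strict_mono r" and lim: "(\<lambda>n. kernel_mean \<sigma> (r n) (of_real (- x))) \<longlonglongrightarrow> L"
  shows "L \<in> \<real>" and "Re L < c 1 * (1 + x * c 1) powr (- \<sigma>)"
proof -
  define m where "m = c 1"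
  define R where "R N = (\<Sum>k\<le>N. bernstein_weight c N k *
    (real k / real N * (1 + x * (real k / real N)) powr (- \<sigma>)))" for N
  have R: "kernel_mean \<sigma> N (of_real (- x)) = of_real (R N)" for N
    unfolding R_def by (rule kernel_mean_neg_real[OF x])
  show "L \<in> \<real>"
    by (rule closed_sequentially[OF closed_complex_Reals _ lim]) (simp only: R Reals_of_real)
  have m: "0 < m" "m \<le> 1"
    using c1 first_le_1 by (simp_all add: m_def)
  obtain d \<kappa> where \<kappa>: "\<kappa> > 0"
    and tangent: "\<And>t. t \<in> {0..1} \<Longrightarrow> t * (1 + x * t) powr (- \<sigma>) \<le>
      m * (1 + x * m) powr (- \<sigma>) + d * (t - m) - \<kappa> * (t - m)\<^sup>2"
    by (rule real_binomial_kernel_tangent[OF x \<sigma> m]) (rule that)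
  \<comment> \<open>The averaged bound involves only the first two moments, so it converges.\<close>
  define G where "G N = m * (1 + x * m) powr (- \<sigma>) + d * (bernstein_moment c N 1 - m) -
    \<kappa> * (bernstein_moment c N 2 - 2 * m * bernstein_moment c N 1 + m\<^sup>2)" for N
  have "R N \<le> G N" for N
  proof -
    have "R N \<le> (\<Sum>k\<le>N. bernstein_weight c N k * (m * (1 + x * m) powr (- \<sigma>) +
        d * (real k / real N - m) - \<kappa> * (real k / real N - m)\<^sup>2))"
      unfolding R_def
    proof (rule sum_mono)
      fix k assume "k \<in> {..N}"
      then have "real k / real N \<in> {0..1}"
        by (auto simp: divide_le_eq_1)
      from mult_left_mono[OF tangent[OF this] weight_nonneg]
      show "bernstein_weight c N k * (real k / real N * (1 + x * (real k / real N)) powr (- \<sigma>)) \<le>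
          bernstein_weight c N k * (m * (1 + x * m) powr (- \<sigma>) +
            d * (real k / real N - m) - \<kappa> * (real k / real N - m)\<^sup>2)" .
    qed
    also have "\<dots> = (\<Sum>k\<le>N. (m * (1 + x * m) powr (- \<sigma>) - d * m - \<kappa> * m\<^sup>2) * bernstein_weight c N k
        + (d + 2 * \<kappa> * m) * (bernstein_weight c N k * (real k / real N) ^ 1)
        - \<kappa> * (bernstein_weight c N k * (real k / real N) ^ 2))"
      by (intro sum.cong) (auto simp: power2_eq_square algebra_simps simp del: times_divide_eq_right times_divide_eq_left)
    also have "\<dots> = G N"
      unfolding sum_subtractf sum.distrib sum_distrib_left[symmetric] sum_weight
        bernstein_moment_def[symmetric] G_def
      by (simp add: algebra_simps)
    finally show ?thesis .
  qed
  then have "Re (kernel_mean \<sigma> (r n) (of_real (- x))) \<le> G (r n)" for n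
    by (simp only: R Re_complex_of_real)
  moreover have "(\<lambda>n. Re (kernel_mean \<sigma> (r n) (of_real (- x)))) \<longlonglongrightarrow> Re L"
    by (intro tendsto_intros lim)
  moreover have "G \<longlonglongrightarrow> m * (1 + x * m) powr (- \<sigma>) + d * (c 1 - m) - \<kappa> * (c 2 - 2 * m * c 1 + m\<^sup>2)"
    unfolding G_def[abs_def] by (intro tendsto_intros moment_tendsto)
  then have "(\<lambda>n. G (r n)) \<longlonglongrightarrow>
      m * (1 + x * m) powr (- \<sigma>) + d * (c 1 - m) - \<kappa> * (c 2 - 2 * m * c 1 + m\<^sup>2)"
    using LIMSEQ_subseq_LIMSEQ[OF _ \<open>strict_mono r\<close>] by (auto simp: o_def)
  ultimately have "Re L \<le> m * (1 + x * m) powr (- \<sigma>) + d * (c 1 - m) - \<kappa> * (c 2 - 2 * m * c 1 + m\<^sup>2)"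
    by (intro LIMSEQ_le) auto
  also have "\<dots> = m * (1 + x * m) powr (- \<sigma>) - \<kappa> * (c 2 - (c 1)\<^sup>2)"
    by (simp add: m_def power2_eq_square)
  also have "\<dots> < m * (1 + x * m) powr (- \<sigma>)"
    using \<kappa> c2 by simp
  finally show "Re L < c 1 * (1 + x * c 1) powr (- \<sigma>)"
    by (simp add: m_def)
qed

end

text \<open>If \<open>a\<close> and \<open>b\<close> agree on \<open>{1..q}\<close>, the series is
  binomial and both sides equal \<open>1 / (1 + x) powr \<sigma>\<close>; the assumption of a
  differing index excludes this equality.\<close>

theorem theorem6:
  fixes q :: nat and a b :: "nat \<Rightarrow> real" and x \<sigma> :: real
  assumes "q \<ge> 1"
    and "weak_supermajorized q b a"
    and "a 1 > 1" and "b 1 > 1"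
    and "\<exists>i\<in>{1..q}. a i \<noteq> b i"
    and "x > 0" and "0 < \<sigma>" and "\<sigma> \<le> 1"
  shows "let F = hypergeometric q (complex_of_real \<sigma>) (\<lambda>i. complex_of_real (a i))
                   (\<lambda>i. complex_of_real (b i)) (complex_of_real (- x))
         in F \<in> \<real> \<and> Re F < 1 / (1 + x * (\<Prod>i=1..q. (a i - 1) / (b i - 1))) powr \<sigma>"
proof -
  define \<alpha> \<beta> where "\<alpha> i = a i - 1" and "\<beta> i = b i - 1" for i
  define c where "c = pochhammer_quotient q \<alpha> \<beta>"
  have maj: "weak_supermajorized q \<beta> \<alpha>"
    using weak_supermajorized_shift[OF assms(2), of "-1"] assms(3,4)
    by (simp add: \<alpha>_def[abs_def] \<beta>_def[abs_def])
  note pos = weak_supermajorized_pos[OF maj]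
  interpret hausdorff_sequence c
    unfolding c_def
    by unfold_locales
       (auto simp: backward_diff_pochhammer_quotient_nonneg[OF maj] pochhammer_quotient_def)
  have c1: "c 1 = (\<Prod>i=1..q. (a i - 1) / (b i - 1))"
    by (simp add: c_def pochhammer_quotient_def \<alpha>_def \<beta>_def)
  have c1_pos: "c 1 > 0"
    unfolding c_def pochhammer_quotient_def by (rule prod_pos) (use pos in auto)
  \<comment> \<open>Writing \<open>\<alpha> i * (\<alpha> i + 1)\<close> as
    \<open>(\<alpha> i)^2 * ((\<alpha> i + 1) / \<alpha> i)\<close> splits off
    \<open>(c 1)^2\<close>.\<close>
  have "c 2 = (\<Prod>i=1..q. (\<alpha> i / \<beta> i)\<^sup>2 * (((\<alpha> i + 1) / \<alpha> i) / ((\<beta> i + 1) / \<beta> i)))"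
    unfolding c_def pochhammer_quotient_def
  proof (rule prod.cong)
    fix i assume "i \<in> {1..q}"
    from pos[OF this] show "pochhammer (\<alpha> i) 2 / pochhammer (\<beta> i) 2 =
        (\<alpha> i / \<beta> i)\<^sup>2 * (((\<alpha> i + 1) / \<alpha> i) / ((\<beta> i + 1) / \<beta> i))"
      by (simp add: numeral_2_eq_2 pochhammer_Suc divide_simps)
  qed simp
  also have "\<dots> = (c 1)\<^sup>2 * ((\<Prod>i=1..q. (\<alpha> i + 1) / \<alpha> i) / (\<Prod>i=1..q. (\<beta> i + 1) / \<beta> i))"
    by (simp only: prod.distrib prod_dividef prod_power_distrib[symmetric] c_def pochhammer_quotient_def
        pochhammer_1)
  finally have c2: "c 2 = (c 1)\<^sup>2 * ((\<Prod>i=1..q. (\<alpha> i + 1) / \<alpha> i) / (\<Prod>i=1..q. (\<beta> i + 1) / \<beta> i))" .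
  have "0 < (\<Prod>i=1..q. (\<beta> i + 1) / \<beta> i)"
    by (intro prod_pos ballI divide_pos_pos add_pos_pos) (use pos in auto)
  moreover have "(\<Prod>i=1..q. (\<beta> i + 1) / \<beta> i) < (\<Prod>i=1..q. (\<alpha> i + 1) / \<alpha> i)"
    using assms(5) by (intro weak_supermajorized_prod_less maj) (auto simp: \<alpha>_def \<beta>_def)
  ultimately have "1 < (\<Prod>i=1..q. (\<alpha> i + 1) / \<alpha> i) / (\<Prod>i=1..q. (\<beta> i + 1) / \<beta> i)"
    by (subst less_divide_eq_1_pos)
  from mult_strict_left_mono[OF this, of "(c 1)\<^sup>2"] have c2_gt: "(c 1)\<^sup>2 < c 2"
    using c1_pos by (simp only: c2) simp
  have coeff: "hypergeometric_coeff q (of_real \<sigma>) (\<lambda>i. of_real (a i)) (\<lambda>i. of_real (b i)) n =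
      of_real (pochhammer \<sigma> n / fact n) * of_real (c (Suc n)) / of_real (c 1)" for n
  proof -
    \<comment> \<open>\<open>pochhammer (\<alpha> i) (Suc n)\<close> has first factor
      \<open>\<alpha> i\<close>, and the rest is \<open>pochhammer (a i) n\<close>; likewise for
      \<beta> and \<open>b\<close>.\<close>
    have "c (Suc n) = c 1 * (\<Prod>i=1..q. pochhammer (a i) n / pochhammer (b i) n)"
      unfolding c_def pochhammer_quotient_def prod.distrib[symmetric]
      by (rule prod.cong) (simp_all add: pochhammer_rec \<alpha>_def \<beta>_def)
    then show ?thesis
      using c1_pos by (simp add: hypergeometric_coeff_def pochhammer_of_real prod_dividef mult_ac)
  qed
  obtain F r where F: "F holomorphic_on cut_plane" "strict_mono (r :: nat \<Rightarrow> nat)"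
      "\<And>z. z \<in> cut_plane \<Longrightarrow> (\<lambda>n. kernel_mean \<sigma> (r n) z) \<longlonglongrightarrow> F z"
      "\<And>z. norm z < 1 \<Longrightarrow>
        (\<lambda>n. of_real (pochhammer \<sigma> n / fact n) * of_real (c (Suc n)) * z ^ n) sums F z"
    by (rule kernel_mean_limit[OF less_imp_le[OF assms(7)] assms(8)]) (rule that)
  have cont: "hypergeometric_continuation q (of_real \<sigma>) (\<lambda>i. of_real (a i)) (\<lambda>i. of_real (b i))
      (\<lambda>z. F z / of_real (c 1))"
    unfolding hypergeometric_continuation_def
  proof (intro conjI ballI)
    show "(\<lambda>z. F z / of_real (c 1)) holomorphic_on cut_plane"
      using c1_pos by (intro holomorphic_intros F(1)) auto
    fix z :: complex assume "z \<in> ball 0 1"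
    then have "norm z < 1"
      by simp
    from sums_divide[OF F(4)[OF this], of "of_real (c 1)"]
    show "(\<lambda>n. hypergeometric_coeff q (of_real \<sigma>) (\<lambda>i. of_real (a i)) (\<lambda>i. of_real (b i)) n * z ^ n)
        sums (F z / of_real (c 1))"
      by (simp add: coeff)
  qed
  have neg: "of_real (- x) \<in> cut_plane"
    using assms(6) unfolding cut_plane_def by (auto simp del: of_real_minus)
  have "F (of_real (- x)) \<in> \<real>" "Re (F (of_real (- x))) < c 1 * (1 + x * c 1) powr (- \<sigma>)"
    using kernel_mean_limit_less[OF assms(6-8) c1_pos c2_gt F(2) F(3)[OF neg]] by auto
  then have "F (of_real (- x)) / of_real (c 1) \<in> \<real>"
    and "Re (F (of_real (- x)) / of_real (c 1)) < 1 / (1 + x * c 1) powr \<sigma>"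
    using c1_pos by (auto simp: field_simps powr_minus)
  then show ?thesis
    unfolding Let_def hypergeometric_eqI[OF cont neg] c1 by blast
qed

end
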